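(* Let $X$ be a separable Banach space, and $Y$ a closed subspace of $X$. Suppose that $(X,Y)$ has the Lipschitz-lifting property. Then the following are equivalent: (i) $(X,Y)$ has the BAP. (ii) $(X,Y)$ has the Lipschitz BAP.
   Context: Banach spaces are real here. For $\lambda\ge 1$, the pair $(X,Y)$ has the $\lambda$-BAP if for each $\varepsilon>0$ and compact $K\subset X$ there is a finite-rank linear map $S:X\to X$ with $\|S\|\le\lambda$, $\|S(x)-x\|\le\varepsilon$ for each $x\in K$, and $S(Y)\subseteq Y$. It has the $\lambda$-Lipschitz BAP if for each $\varepsilon>0$ and compact $K\subset X$ there is a Lipschitz map $S:X\to X$ with range contained in a finite-dimensional subspace, $S(Y)\subseteq Y$, Lipschitz constant $\mathrm{Lip}(S)\le\lambda$, and $\|S(x)-x\|\le\varepsilon$ for each $x\in K$. The BAP (resp. Lipschitz BAP) means the $\lambda$-BAP (resp. $\lambda$-Lipschitz BAP) for some $\lambda$. For a pointed metric space $M$ (distinguished point $0$), $\mathrm{Lip}_0(M)$ is the Banach space of Lipschitz functions $f:M\to\mathbb{R}$ with $f(0)=0$, normed by the Lipschitz constant. The Lipschitz-free space $\mathscr{F}(M)$ is the closed linear span in $\mathrm{Lip}_0(M)^*$ of the evaluation functionals $\delta(x):f\mapsto f(x)$, $x\in M$. Every Lipschitz map $T:M\to Z$ into a Banach space with $T(0)=0$ extends uniquely to a bounded linear $\overline T:\mathscr{F}(M)\to Z$ with $\overline T\circ\delta=T$, and $\|\overline T\|=\mathrm{Lip}(T)$. If $N\subseteq M$ contains $0$,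 $\mathscr{F}(N)$ is identified with the closed span of $\delta(N)$ in $\mathscr{F}(M)$. For a Banach space $X$ (pointed at its origin), the barycentric map $\beta_X:\mathscr{F}(X)\to X$ is the norm-one linear map with $\beta_X(\delta(x))=x$ for all $x\in X$. The pair $(X,Y)$ has the Lipschitz-lifting property if there is a continuous linear map $T:X\to\mathscr{F}(X)$ with $T(Y)\subseteq\mathscr{F}(Y)$ and $\beta_X\circ T=\mathrm{Id}_X$. *)

theory Defs
  imports "HOL-Analysis.Analysis"
begin

section \<open>The space of Lipschitz functions vanishing at the base point\<close>

text \<open>A pointed metric space is a type of class metric_space carrying a constant 0, the
  distinguished point.\<close>

typedef (overloaded) 'a lip0 =
  "{f :: 'a::{metric_space, zero} \<Rightarrow> real. f 0 = 0 \<and> (\<exists>L. L-lipschitz_on UNIV f)}"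
  morphisms lip0_apply Lip0
  by (rule exI[where x="\<lambda>_. 0"]) (auto simp: lipschitz_on_def)

setup_lifting type_definition_lip0

definition Lip_const :: "('a::metric_space \<Rightarrow> 'b::metric_space) \<Rightarrow> real"
  where "Lip_const f = Inf {L. L-lipschitz_on UNIV f}"

lemma Lip_const_lipschitz:
  assumes "L-lipschitz_on UNIV f"
  shows "(Lip_const f)-lipschitz_on UNIV f"
proof (rule lipschitz_onI)
  have ne: "{L. L-lipschitz_on UNIV f} \<noteq> {}" using assms by auto
  show "0 \<le> Lip_const f"
    unfolding Lip_const_def using ne by (intro cInf_greatest) (auto simp: lipschitz_on_def)
  fix x y
  show "dist (f x) (f y) \<le> Lip_const f * dist x y"
  proof (cases "x = y")
    case False
    then have "dist (f x) (f y) / dist x y \<le> Lip_const f"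
      unfolding Lip_const_def using ne
      by (intro cInf_greatest) (auto simp: lipschitz_on_def divide_le_eq)
    with False show ?thesis by (simp add: divide_le_eq)
  qed simp
qed

lemma Lip_const_le:
  assumes "L-lipschitz_on UNIV f"
  shows "Lip_const f \<le> L"
  unfolding Lip_const_def using assms
  by (intro cInf_lower) (auto simp: bdd_below_def lipschitz_on_def)

lemma Lip_const_nonneg: "L-lipschitz_on UNIV f \<Longrightarrow> 0 \<le> Lip_const f"
  by (rule lipschitz_on_nonneg[OF Lip_const_lipschitz])

instantiation lip0 :: ("{metric_space, zero}") real_normed_vector
begin

lift_definition norm_lip0 :: "'a lip0 \<Rightarrow> real" is Lip_const .

lift_definition zero_lip0 :: "'a lip0" is "\<lambda>_. 0"
  by (auto simp: lipschitz_on_def)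

lemma lip0_add_closed:
  fixes f g :: "'a \<Rightarrow> real"
  assumes "L-lipschitz_on UNIV f" "M-lipschitz_on UNIV g"
  shows "(L + M)-lipschitz_on UNIV (\<lambda>x. f x + g x)"
  using assms by (rule lipschitz_on_add)

lemma lip0_scale_closed:
  fixes f :: "'a \<Rightarrow> real"
  assumes "L-lipschitz_on UNIV f"
  shows "(\<bar>c\<bar> * L)-lipschitz_on UNIV (\<lambda>x. c * f x)"
proof (rule lipschitz_onI)
  show "0 \<le> \<bar>c\<bar> * L" using lipschitz_on_nonneg[OF assms] by simp
  fix x y
  have "dist (c * f x) (c * f y) = \<bar>c\<bar> * dist (f x) (f y)"
    by (simp add: dist_real_def abs_mult flip: right_diff_distrib)
  also have "\<dots> \<le> \<bar>c\<bar> * (L * dist x y)"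
    using lipschitz_onD[OF assms] by (intro mult_left_mono) auto
  finally show "dist (c * f x) (c * f y) \<le> \<bar>c\<bar> * L * dist x y" by simp
qed

lift_definition plus_lip0 :: "'a lip0 \<Rightarrow> 'a lip0 \<Rightarrow> 'a lip0" is "\<lambda>f g x. f x + g x"
proof -
  fix f g :: "'a \<Rightarrow> real"
  assume fg: "f 0 = 0 \<and> (\<exists>L. L-lipschitz_on UNIV f)" "g 0 = 0 \<and> (\<exists>L. L-lipschitz_on UNIV g)"
  then obtain L M where "L-lipschitz_on UNIV f" "M-lipschitz_on UNIV g" by blast
  from lip0_add_closed[OF this] fg
  show "f 0 + g 0 = 0 \<and> (\<exists>L. L-lipschitz_on UNIV (\<lambda>x. f x + g x))" by auto
qed

lift_definition uminus_lip0 :: "'a lip0 \<Rightarrow> 'a lip0" is "\<lambda>f x. - f x"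
proof -
  fix f :: "'a \<Rightarrow> real"
  assume f: "f 0 = 0 \<and> (\<exists>L. L-lipschitz_on UNIV f)"
  then obtain L where "L-lipschitz_on UNIV f" by blast
  from lip0_scale_closed[OF this, of "-1"] f
  show "- f 0 = 0 \<and> (\<exists>L. L-lipschitz_on UNIV (\<lambda>x. - f x))" by auto
qed

lift_definition minus_lip0 :: "'a lip0 \<Rightarrow> 'a lip0 \<Rightarrow> 'a lip0" is "\<lambda>f g x. f x - g x"
proof -
  fix f g :: "'a \<Rightarrow> real"
  assume fg: "f 0 = 0 \<and> (\<exists>L. L-lipschitz_on UNIV f)" "g 0 = 0 \<and> (\<exists>L. L-lipschitz_on UNIV g)"
  then obtain L M where "L-lipschitz_on UNIV f" "M-lipschitz_on UNIV g" by blast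
  from lipschitz_on_diff[OF this] fg
  show "f 0 - g 0 = 0 \<and> (\<exists>L. L-lipschitz_on UNIV (\<lambda>x. f x - g x))" by auto
qed

lift_definition scaleR_lip0 :: "real \<Rightarrow> 'a lip0 \<Rightarrow> 'a lip0" is "\<lambda>c f x. c * f x"
proof -
  fix c and f :: "'a \<Rightarrow> real"
  assume f: "f 0 = 0 \<and> (\<exists>L. L-lipschitz_on UNIV f)"
  then obtain L where "L-lipschitz_on UNIV f" by blast
  from lip0_scale_closed[OF this, of c] f
  show "c * f 0 = 0 \<and> (\<exists>L. L-lipschitz_on UNIV (\<lambda>x. c * f x))" by auto
qed

lemma lip0_eqI: "(\<And>x. lip0_apply f x = lip0_apply g x) \<Longrightarrow> f = g"
  by (simp add: ext flip: lip0_apply_inject)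

lemma lip0_apply_simps:
  "lip0_apply 0 x = 0"
  "lip0_apply (f + g) x = lip0_apply f x + lip0_apply g x"
  "lip0_apply (f - g) x = lip0_apply f x - lip0_apply g x"
  "lip0_apply (- f) x = - lip0_apply f x"
  "lip0_apply (c *\<^sub>R f) x = c * lip0_apply f x"
  by (transfer, rule refl)+

definition dist_lip0 :: "'a lip0 \<Rightarrow> 'a lip0 \<Rightarrow> real"
  where "dist_lip0 f g = norm (f - g)"

definition sgn_lip0 :: "'a lip0 \<Rightarrow> 'a lip0"
  where "sgn_lip0 f = inverse (norm f) *\<^sub>R f"

definition uniformity_lip0 :: "('a lip0 \<times> 'a lip0) filter"
  where "uniformity_lip0 = (INF e\<in>{0 <..}. principal {(x, y). dist x y < e})"

definition open_lip0 :: "'a lip0 set \<Rightarrow> bool"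
  where "open_lip0 S = (\<forall>x\<in>S. \<forall>\<^sub>F (x', y) in uniformity. x' = x \<longrightarrow> y \<in> S)"

instance
proof
  fix f g :: "'a lip0" and a b :: real
  show "dist f g = norm (f - g)" by (rule dist_lip0_def)
  show "sgn f = inverse (norm f) *\<^sub>R f" by (rule sgn_lip0_def)
  show "(uniformity :: ('a lip0 \<times> 'a lip0) filter) = (INF e\<in>{0 <..}. principal {(x, y). dist x y < e})"
    by (rule uniformity_lip0_def)
  show "open U = (\<forall>x\<in>U. \<forall>\<^sub>F (x', y) in uniformity. x' = x \<longrightarrow> y \<in> U)" for U :: "'a lip0 set"
    by (rule open_lip0_def)
  show "(norm f = 0) = (f = 0)"
  proof transfer
    fix f :: "'a \<Rightarrow> real" assume f: "f 0 = 0 \<and> (\<exists>L. L-lipschitz_on UNIV f)"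
    then have lf: "(Lip_const f)-lipschitz_on UNIV f" by (auto intro: Lip_const_lipschitz)
    show "(Lip_const f = 0) = (f = (\<lambda>_. 0))"
    proof
      assume "Lip_const f = 0"
      with lf have "0-lipschitz_on UNIV f" by simp
      from lipschitz_onD[OF this, of _ 0] f show "f = (\<lambda>_. 0)" by (auto simp: dist_real_def)
    next
      assume e: "f = (\<lambda>_. 0)"
      have "0-lipschitz_on UNIV f" by (simp add: lipschitz_on_def e)
      from Lip_const_le[OF this] Lip_const_nonneg[OF this] show "Lip_const f = 0" by simp
    qed
  qed
  show "norm (f + g) \<le> norm f + norm g"
  proof transfer
    fix f g :: "'a \<Rightarrow> real"
    assume "f 0 = 0 \<and> (\<exists>L. L-lipschitz_on UNIV f)" "g 0 = 0 \<and> (\<exists>L. L-lipschitz_on UNIV g)"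
    then obtain L M where "L-lipschitz_on UNIV f" "M-lipschitz_on UNIV g" by blast
    then show "Lip_const (\<lambda>x. f x + g x) \<le> Lip_const f + Lip_const g"
      by (intro Lip_const_le lip0_add_closed) (erule Lip_const_lipschitz)+
  qed
  show "norm (a *\<^sub>R f) = \<bar>a\<bar> * norm f"
  proof transfer
    fix a :: real and f :: "'a \<Rightarrow> real"
    assume "f 0 = 0 \<and> (\<exists>L. L-lipschitz_on UNIV f)"
    then have lf: "(Lip_const f)-lipschitz_on UNIV f" by (auto intro: Lip_const_lipschitz)
    note laf = lip0_scale_closed[OF lf, of a]
    show "Lip_const (\<lambda>x. a * f x) = \<bar>a\<bar> * Lip_const f"
    proof (rule antisym)
      show "Lip_const (\<lambda>x. a * f x) \<le> \<bar>a\<bar> * Lip_const f" by (rule Lip_const_le[OF laf])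
      show "\<bar>a\<bar> * Lip_const f \<le> Lip_const (\<lambda>x. a * f x)"
      proof (cases "a = 0")
        case True then show ?thesis using Lip_const_nonneg[OF laf] by simp
      next
        case False
        from lip0_scale_closed[OF Lip_const_lipschitz[OF laf], of "inverse a"] False
        have "(inverse \<bar>a\<bar> * Lip_const (\<lambda>x. a * f x))-lipschitz_on UNIV f"
          by (simp add: mult.assoc[symmetric] abs_inverse)
        from Lip_const_le[OF this] False show ?thesis by (simp add: field_simps)
      qed
    qed
  qed
qed (rule lip0_eqI, simp add: lip0_apply_simps algebra_simps)+

end

lemma lip0_lipschitz: "(norm f)-lipschitz_on UNIV (lip0_apply f)"
proof transfer
  fix f :: "'a \<Rightarrow> real"
  assume "f 0 = 0 \<and> (\<exists>L. L-lipschitz_on UNIV f)"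
  then obtain L where "L-lipschitz_on UNIV f" by blast
  then show "(Lip_const f)-lipschitz_on UNIV f" by (rule Lip_const_lipschitz)
qed

lemma lip0_zero: "lip0_apply f 0 = 0"
  by transfer simp

lemma lip0_bound: "\<bar>lip0_apply f x\<bar> \<le> norm f * dist x 0"
  using lipschitz_onD[OF lip0_lipschitz[of f], of x 0] by (simp add: lip0_zero dist_real_def)


section \<open>The Lipschitz-free space\<close>

lift_definition ev :: "'a::{metric_space, zero} \<Rightarrow> 'a lip0 \<Rightarrow>\<^sub>L real" is "\<lambda>x f. lip0_apply f x"
proof -
  fix x :: 'a
  show "bounded_linear (\<lambda>f. lip0_apply f x)"
    by (rule bounded_linear_intro[where K="dist x 0"]) (auto simp: lip0_apply_simps lip0_bound)
qed

typedef (overloaded) 'a free =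
  "closure (span (range (ev :: 'a::{metric_space, zero} \<Rightarrow> 'a lip0 \<Rightarrow>\<^sub>L real)))"
  morphisms free_apply Free
  by (rule exI[where x=0], rule subsetD[OF closure_subset], rule span_zero)

setup_lifting type_definition_free

lemma subspace_closure:
  fixes A :: "'b::real_normed_vector set"
  assumes A: "subspace A"
  shows "subspace (closure A)"
proof (rule subspaceI)
  show "0 \<in> closure A" by (rule subsetD[OF closure_subset], rule subspace_0[OF A])
  fix x assume "x \<in> closure A"
  then obtain f where f: "\<And>n. f n \<in> A" "f \<longlonglongrightarrow> x" unfolding closure_sequential by blast
  show "c *\<^sub>R x \<in> closure A" for c
    unfolding closure_sequential
    by (rule exI[where x="\<lambda>n. c *\<^sub>R f n"])
      (intro conjI allI subspace_scale[OF A] f tendsto_scaleR tendsto_const)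
  fix y assume "y \<in> closure A"
  then obtain g where g: "\<And>n. g n \<in> A" "g \<longlonglongrightarrow> y" unfolding closure_sequential by blast
  show "x + y \<in> closure A"
    unfolding closure_sequential
    by (rule exI[where x="\<lambda>n. f n + g n"]) (intro conjI allI subspace_add[OF A] f g tendsto_add)
qed

lemma subspace_free: "subspace (closure (span (range ev)))"
  by (intro subspace_closure subspace_span)

instantiation free :: ("{metric_space, zero}") real_normed_vector
begin

lift_definition norm_free :: "'a free \<Rightarrow> real" is norm .

lift_definition zero_free :: "'a free" is 0
  by (rule subspace_0[OF subspace_free])

lift_definition plus_free :: "'a free \<Rightarrow> 'a free \<Rightarrow> 'a free" is "(+)"
  by (rule subspace_add[OF subspace_free])

lift_definition uminus_free :: "'a free \<Rightarrow> 'a free" is uminus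
  by (rule subspace_neg[OF subspace_free])

lift_definition minus_free :: "'a free \<Rightarrow> 'a free \<Rightarrow> 'a free" is "(-)"
  by (rule subspace_diff[OF subspace_free])

lift_definition scaleR_free :: "real \<Rightarrow> 'a free \<Rightarrow> 'a free" is scaleR
  by (rule subspace_scale[OF subspace_free])

lemma free_apply_simps:
  "free_apply 0 = 0"
  "free_apply (f + g) = free_apply f + free_apply g"
  "free_apply (f - g) = free_apply f - free_apply g"
  "free_apply (- f) = - free_apply f"
  "free_apply (c *\<^sub>R f) = c *\<^sub>R free_apply f"
  "norm (free_apply f) = norm f"
  by (rule zero_free.rep_eq plus_free.rep_eq minus_free.rep_eq uminus_free.rep_eq scaleR_free.rep_eq
      norm_free.rep_eq[symmetric])+

definition dist_free :: "'a free \<Rightarrow> 'a free \<Rightarrow> real"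
  where "dist_free f g = norm (f - g)"

definition sgn_free :: "'a free \<Rightarrow> 'a free"
  where "sgn_free f = inverse (norm f) *\<^sub>R f"

definition uniformity_free :: "('a free \<times> 'a free) filter"
  where "uniformity_free = (INF e\<in>{0 <..}. principal {(x, y). dist x y < e})"

definition open_free :: "'a free set \<Rightarrow> bool"
  where "open_free S = (\<forall>x\<in>S. \<forall>\<^sub>F (x', y) in uniformity. x' = x \<longrightarrow> y \<in> S)"

instance
proof
  fix f g :: "'a free" and a b :: real
  show "dist f g = norm (f - g)" by (rule dist_free_def)
  show "sgn f = inverse (norm f) *\<^sub>R f" by (rule sgn_free_def)
  show "(uniformity :: ('a free \<times> 'a free) filter) = (INF e\<in>{0 <..}. principal {(x, y). dist x y < e})"
    by (rule uniformity_free_def)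
  show "open U = (\<forall>x\<in>U. \<forall>\<^sub>F (x', y) in uniformity. x' = x \<longrightarrow> y \<in> U)" for U :: "'a free set"
    by (rule open_free_def)
  show "norm (f + g) \<le> norm f + norm g"
    by (simp add: free_apply_simps norm_triangle_ineq flip: free_apply_simps(6))
  show "(norm f = 0) = (f = 0)"
    by (metis free_apply_inject free_apply_simps(1,6) norm_eq_zero)
  show "norm (a *\<^sub>R f) = \<bar>a\<bar> * norm f"
    by (simp add: free_apply_simps flip: free_apply_simps(6))
qed (simp add: free_apply_simps algebra_simps flip: free_apply_inject)+

end

lemma bounded_linear_free_apply: "bounded_linear free_apply"
  by (rule bounded_linear_intro[where K=1]) (simp_all add: free_apply_simps)

lemma dist_free_apply: "dist (free_apply a) (free_apply b) = dist a b"
  by (simp add: dist_norm flip: free_apply_simps)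

instance free :: ("{metric_space, zero}") banach
proof
  fix X :: "nat \<Rightarrow> 'a free"
  assume "Cauchy X"
  then have "Cauchy (\<lambda>n. free_apply (X n))"
    by (simp add: Cauchy_def dist_free_apply)
  then obtain l where l: "(\<lambda>n. free_apply (X n)) \<longlonglongrightarrow> l"
    unfolding Cauchy_convergent_iff convergent_def ..
  have "l \<in> closure (span (range ev))"
    by (rule closed_sequentially[OF closed_closure free_apply l])
  then have "l = free_apply (Free l)" by (simp add: Free_inverse)
  with l have "(\<lambda>n. free_apply (X n)) \<longlonglongrightarrow> free_apply (Free l)" by simp
  then have "X \<longlonglongrightarrow> Free l" by (simp only: tendsto_iff dist_free_apply)
  then show "convergent X" unfolding convergent_def ..
qed

lift_definition delta :: "'a::{metric_space, zero} \<Rightarrow> 'a free" is ev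
  by (rule subsetD[OF closure_subset], rule span_base, rule rangeI)

lemma closure_span_delta: "closure (span (range delta)) = UNIV"
proof -
  have "\<mu> \<in> closure (span (range delta))" for \<mu> :: "'a free"
  proof -
    have "range (ev :: 'a \<Rightarrow> _) = free_apply ` range delta"
      by (auto simp: delta.rep_eq image_image)
    then have im: "span (range (ev :: 'a \<Rightarrow> _)) = free_apply ` span (range delta)"
      by (simp add: linear_span_image bounded_linear.linear[OF bounded_linear_free_apply])
    obtain s where s: "\<And>n. s n \<in> span (range ev)" "s \<longlonglongrightarrow> free_apply \<mu>"
      using free_apply[of \<mu>] unfolding closure_sequential by blast
    then have "\<forall>n. \<exists>m. m \<in> span (range delta) \<and> s n = free_apply m"
      unfolding im by blast
    then obtain m where m: "\<And>n. m n \<in> span (range delta)" "\<And>n. s n = free_apply (m n)"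
      by metis
    have "m \<longlonglongrightarrow> \<mu>"
      using s(2) by (simp only: m(2) tendsto_iff dist_free_apply)
    with m(1) show ?thesis unfolding closure_sequential by blast
  qed
  then show ?thesis by blast
qed

text \<open>The canonical copy of the Lipschitz-free space over a subset N containing 0 inside the
  Lipschitz-free space over the whole metric space.\<close>

definition free_sub :: "'a::{metric_space, zero} set \<Rightarrow> 'a free set"
  where "free_sub N = closure (span (delta ` N))"


section \<open>The barycentric map\<close>

definition barycentric :: "'a::banach free \<Rightarrow>\<^sub>L 'a"
  where "barycentric = (THE b. \<forall>x. blinfun_apply b (delta x) = x)"

text \<open>The rest of this section shows that this description determines a map, and that its norm
  is at most 1. This needs norming functionals on finite-dimensional subspaces and their
  extension to Lipschitz functions on the whole space.\<close>

lemma norming_step: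
  fixes g :: "'a::real_normed_vector \<Rightarrow> real"
  assumes g: "linear g" and bd: "\<And>u. u \<in> span S \<Longrightarrow> g u \<le> norm u"
  shows "\<exists>h. linear h \<and> (\<forall>u\<in>span (insert a S). h u \<le> norm u) \<and> (\<forall>u\<in>span S. h u = g u)"
proof (cases "a \<in> span S")
  case True
  then have "span (insert a S) = span S" by (rule span_redundant)
  with g bd show ?thesis by auto
next
  case False
  obtain B where B: "B \<subseteq> span S" "independent B" "span S \<subseteq> span B"
    using basis_exists by metis
  then have sB: "span B = span S" by (metis span_minimal subspace_span subset_antisym)
  with False B have "independent (insert a B)"
    by (simp add: independent_insertI)
  then obtain l :: "'a \<Rightarrow> real" where l: "linear l" "\<forall>x\<in>insert a B. l x = (if x = a then 1 else 0)"
    using linear_independent_extend[of "insert a B" "\<lambda>x. if x = a then 1 else 0"] by blast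
  have aB: "a \<notin> B" using False B by blast
  have l0: "l u = 0" if "u \<in> span S" for u
  proof (rule linear_eq_0_on_span[OF l(1), of B])
    show "l x = 0" if "x \<in> B" for x using l(2) aB that by auto
    show "u \<in> span B" using that sB by simp
  qed
  have la: "l a = 1" using l(2) by simp
  define c where "c = (SUP u\<in>span S. g u - norm (u - a))"
  have key: "g u - norm (u - a) \<le> norm (w + a) - g w" if "u \<in> span S" "w \<in> span S" for u w
  proof -
    have "g u + g w = g (u + w)" using g by (simp add: linear_add)
    also have "\<dots> \<le> norm (u + w)" using bd that span_add by blast
    also have "\<dots> = norm ((u - a) + (w + a))" by simp
    also have "\<dots> \<le> norm (u - a) + norm (w + a)" by (rule norm_triangle_ineq)
    finally show ?thesis by simp
  qed
  have ne: "span S \<noteq> {}" using span_zero by blast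
  have cu: "c \<le> norm (w + a) - g w" if "w \<in> span S" for w
    unfolding c_def using ne key that by (intro cSUP_least) auto
  have cl: "g u - norm (u - a) \<le> c" if "u \<in> span S" for u
    unfolding c_def using key[OF _ span_zero] that
    by (intro cSUP_upper bdd_aboveI2[where M="norm (0 + a) - g 0"]) auto
  define h where "h = (\<lambda>u. g u + (c - g a) * l u)"
  have hl: "linear h" unfolding h_def
    using g l(1) by (intro linear_compose_add linear_compose[of l "\<lambda>x. (c - g a) * x", unfolded o_def])
      (auto intro: linearI simp: algebra_simps)
  have hS: "h u = g u" if "u \<in> span S" for u using l0 that by (simp add: h_def)
  have ha: "h a = c" by (simp add: h_def la)
  have "h x \<le> norm x" if x: "x \<in> span (insert a S)" for x
  proof -
    from x obtain k where k: "x - k *\<^sub>R a \<in> span S" by (auto simp: span_breakdown_eq)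
    define w where "w = x - k *\<^sub>R a"
    have w: "w \<in> span S" using k by (simp add: w_def)
    have xw: "x = w + k *\<^sub>R a" by (simp add: w_def)
    have hx: "h x = g w + k * c" using hl hS[OF w] ha by (simp add: xw linear_add linear_scale)
    consider "k = 0" | "k > 0" | "k < 0" by linarith
    then show ?thesis
    proof cases
      case 1 then show ?thesis using hx bd[OF w] xw by simp
    next
      case 2
      have "k * c \<le> k * (norm (inverse k *\<^sub>R w + a) - g (inverse k *\<^sub>R w))"
        using 2 cu[OF span_scale[OF w]] by (intro mult_left_mono) auto
      also have "\<dots> = norm (k *\<^sub>R (inverse k *\<^sub>R w + a)) - g w"
        using 2 g by (simp add: linear_scale right_diff_distrib)
      also have "k *\<^sub>R (inverse k *\<^sub>R w + a) = x" using 2 by (simp add: xw scaleR_add_right)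
      finally show ?thesis using hx by simp
    next
      case 3
      define m where "m = - k"
      have m: "m > 0" using 3 by (simp add: m_def)
      have "m * (g (inverse m *\<^sub>R w) - norm (inverse m *\<^sub>R w - a)) \<le> m * c"
        using m cl[OF span_scale[OF w]] by (intro mult_left_mono) auto
      moreover have "m * (g (inverse m *\<^sub>R w) - norm (inverse m *\<^sub>R w - a))
          = g w - norm (m *\<^sub>R (inverse m *\<^sub>R w - a))"
        using m g by (simp add: linear_scale right_diff_distrib)
      moreover have "m *\<^sub>R (inverse m *\<^sub>R w - a) = x"
        using m by (simp add: xw scaleR_diff_right m_def)
      ultimately have "g w - norm x \<le> m * c" by metis
      then show ?thesis using hx by (simp add: m_def)
    qed
  qed
  with hl hS show ?thesis by blast
qed

lemma norming_functional:
  fixes v :: "'a::real_normed_vector"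
  assumes "finite F"
  shows "\<exists>g. linear g \<and> (\<forall>u\<in>span (insert v F). g u \<le> norm u) \<and> g v = norm v"
  using assms
proof induction
  case empty
  show ?case
  proof (cases "v = 0")
    case True
    then show ?thesis
      by (intro exI[where x="\<lambda>_. 0"]) (auto intro: linearI)
  next
    case False
    then have "independent {v}" by simp
    then obtain l :: "'a \<Rightarrow> real" where l: "linear l" "\<forall>x\<in>{v}. l x = norm v"
      using linear_independent_extend[of "{v}" "\<lambda>_. norm v"] by blast
    have "l u \<le> norm u" if "u \<in> span {v}" for u
      using that l by (auto simp: span_singleton linear_scale mult_right_mono)
    with l show ?thesis by auto
  qed
next
  case (insert a F)
  then obtain g where g: "linear g" "\<And>u. u \<in> span (insert v F) \<Longrightarrow> g u \<le> norm u" "g v = norm v"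
    by blast
  from norming_step[OF g(1,2), of "insert v F" a] obtain h where
    h: "linear h" "\<forall>u\<in>span (insert a (insert v F)). h u \<le> norm u"
       "\<forall>u\<in>span (insert v F). h u = g u" by blast
  have "h v = norm v" using h(3) g(3) span_base by (metis insertI1)
  with h show ?case by (auto simp: insert_commute)
qed

lemma norming_lip0:
  fixes v :: "'a::real_normed_vector"
  assumes "finite F" "v \<in> span F"
  shows "\<exists>f :: 'a lip0. norm f \<le> 1 \<and> lip0_apply f v = norm v \<and>
    (\<exists>g. linear g \<and> (\<forall>u\<in>span F. lip0_apply f u = g u))"
proof -
  from norming_functional[OF assms(1), of v] obtain g where
    g: "linear g" "\<And>u. u \<in> span (insert v F) \<Longrightarrow> g u \<le> norm u" "g v = norm v" by blast
  from assms(2) have sp: "span (insert v F) = span F" by (rule span_redundant)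
  note g2 = g(2)[unfolded sp]
  define f where "f = (\<lambda>x. INF s\<in>span F. g s + norm (x - s))"
  have ne: "span F \<noteq> {}" using span_zero by blast
  have lb: "- norm x \<le> g s + norm (x - s)" if "s \<in> span F" for x s
  proof -
    have "- g s = g (- s)" using g(1) by (simp add: linear_neg)
    also have "\<dots> \<le> norm (- s)" using g2 that span_neg by blast
    also have "\<dots> \<le> norm x + norm (x - s)"
      using norm_triangle_ineq4[of x "x - s"] by simp
    finally show ?thesis by simp
  qed
  have fle: "f x \<le> g s + norm (x - s)" if "s \<in> span F" for x s
    unfolding f_def using lb that by (intro cINF_lower bdd_belowI2[where m="- norm x"]) auto
  have fg: "f u = g u" if u: "u \<in> span F" for u
  proof (rule antisym)
    show "f u \<le> g u" using fle[OF u, of u] by simp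
    show "g u \<le> f u" unfolding f_def
    proof (rule cINF_greatest[OF ne])
      fix s assume s: "s \<in> span F"
      have "g u - g s = g (u - s)" using g(1) by (simp add: linear_diff)
      also have "\<dots> \<le> norm (u - s)" using g2 u s span_diff by blast
      finally show "g u \<le> g s + norm (u - s)" by simp
    qed
  qed
  have half: "f x - dist x y \<le> f y" for x y
    unfolding f_def
  proof (rule cINF_greatest[OF ne])
    fix s assume s: "s \<in> span F"
    have "f x \<le> g s + norm (x - s)" by (rule fle[OF s])
    also have "norm (x - s) \<le> norm (x - y) + norm (y - s)"
      using norm_triangle_ineq[of "x - y" "y - s"] by simp
    finally show "(INF s\<in>span F. g s + norm (x - s)) - dist x y \<le> g s + norm (y - s)"
      by (simp add: f_def dist_norm)
  qed
  have lip: "1-lipschitz_on UNIV f"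
  proof (rule lipschitz_onI)
    fix x y
    show "dist (f x) (f y) \<le> 1 * dist x y"
      using half[of x y] half[of y x] by (simp add: dist_real_def dist_commute)
  qed simp
  have f0: "f 0 = 0" using fg[OF span_zero] g(1) by (simp add: linear_0)
  have F: "lip0_apply (Lip0 f) = f" using lip f0 by (intro Lip0_inverse) auto
  have "norm (Lip0 f) \<le> 1" using Lip_const_le[OF lip] by (simp add: norm_lip0.rep_eq F)
  moreover have "f v = norm v" using fg[OF assms(2)] g(3) by simp
  ultimately show ?thesis using F fg g(1) by (intro exI[where x="Lip0 f"]) auto
qed

lemma free_apply_delta: "blinfun_apply (free_apply (delta x)) f = lip0_apply f x"
  by (simp add: delta.rep_eq ev.rep_eq)

lemma barycentric_graph_bound:
  fixes p :: "'a::real_normed_vector free \<times> 'a"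
  assumes "p \<in> span (range (\<lambda>x. (delta x, x)))"
  shows "norm (snd p) \<le> norm (fst p)"
proof -
  let ?d = "\<lambda>x::'a. (delta x, x)"
  have "\<exists>t. finite t \<and> t \<subseteq> range ?d \<and> p \<in> span t"
    using assms
  proof (induction rule: span_induct_alt)
    case base
    show ?case by (rule exI[where x="{}"]) simp
  next
    case (step c x y)
    then obtain t where t: "finite t" "t \<subseteq> range ?d" "y \<in> span t" by blast
    have "c *\<^sub>R x + y \<in> span (insert x t)"
      using t(3) by (intro span_add span_scale) (auto intro: span_base span_mono[THEN subsetD])
    with t(1,2) step.hyps show ?case by (intro exI[where x="insert x t"]) auto
  qed
  then obtain t where t: "finite t" "t \<subseteq> range ?d" "p \<in> span t" by blast
  from finite_subset_image[OF t(1,2)] obtain F where F: "finite F" "t = ?d ` F" by blast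
  have snd_in: "snd q \<in> span F" if "q \<in> span t" for q
    using that by (induction rule: span_induct_alt)
      (auto simp: F(2) intro!: span_add[OF span_scale[OF span_base]] span_zero)
  obtain f :: "'a lip0" and g where f: "norm f \<le> 1" "lip0_apply f (snd p) = norm (snd p)"
    and g: "linear g" "\<forall>u\<in>span F. lip0_apply f u = g u"
    using norming_lip0[OF F(1) snd_in[OF t(3)]] by blast
  have "blinfun_apply (free_apply (fst q)) f = g (snd q)" if "q \<in> span t" for q
    using that
  proof (induction rule: span_induct_alt)
    case base
    show ?case using g(1) by (simp add: free_apply_simps linear_0)
  next
    case (step c x y)
    then obtain z where z: "z \<in> F" "x = ?d z" using F(2) by blast
    with g(2) have "lip0_apply f z = g z" using span_base by blast
    with step z g(1) show ?case
      by (simp add: free_apply_simps blinfun.bilinear_simps free_apply_delta linear_add linear_scale)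
  qed
  from this[OF t(3)] g(2) snd_in[OF t(3)] f(2)
  have "norm (snd p) = blinfun_apply (free_apply (fst p)) f" by simp
  also have "\<dots> \<le> norm (blinfun_apply (free_apply (fst p)) f)" by simp
  also have "\<dots> \<le> norm (free_apply (fst p)) * norm f" by (rule norm_blinfun)
  also have "\<dots> \<le> norm (free_apply (fst p)) * 1" using f(1) by (intro mult_left_mono) auto
  finally show ?thesis by (simp add: free_apply_simps)
qed

lemma barycentric_exists:
  "\<exists>b :: 'a::banach free \<Rightarrow>\<^sub>L 'a. norm b \<le> 1 \<and> (\<forall>x. blinfun_apply b (delta x) = x)"
proof -
  define G where "G = span (range (\<lambda>x::'a. (delta x, x)))"
  have sub: "subspace (closure G)" unfolding G_def by (intro subspace_closure subspace_span)
  have bd: "norm v \<le> norm \<mu>" if "(\<mu>, v) \<in> closure G" for \<mu> v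
  proof -
    from that obtain q where q: "\<And>n. q n \<in> G" "q \<longlonglongrightarrow> (\<mu>, v)"
      unfolding closure_sequential by blast
    from tendsto_fst[OF q(2)] tendsto_snd[OF q(2)]
    have "(\<lambda>n. norm (fst (q n))) \<longlonglongrightarrow> norm \<mu>" "(\<lambda>n. norm (snd (q n))) \<longlonglongrightarrow> norm v"
      by (auto intro: tendsto_norm)
    moreover have "norm (snd (q n)) \<le> norm (fst (q n))" for n
      using barycentric_graph_bound q(1) unfolding G_def by blast
    ultimately show ?thesis using LIMSEQ_le by blast
  qed
  have ex: "\<exists>v. (\<mu>, v) \<in> closure G" for \<mu>
  proof -
    have "fst ` range (\<lambda>x::'a. (delta x, x)) = range delta" by (auto simp: image_image)
    then have im: "span (range delta) = fst ` G"
      unfolding G_def by (metis linear_fst linear_span_image)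
    have "\<mu> \<in> closure (span (range delta))" by (simp add: closure_span_delta)
    then obtain s where s: "\<And>n. s n \<in> fst ` G" "s \<longlonglongrightarrow> \<mu>"
      unfolding closure_sequential im by blast
    then have "\<forall>n. \<exists>v. (s n, v) \<in> G" by force
    then obtain v where v: "\<And>n. (s n, v n) \<in> G" by metis
    have "dist (v m) (v n) \<le> dist (s m) (s n)" for m n
    proof -
      have "(s m, v m) - (s n, v n) \<in> G" using v unfolding G_def by (intro span_diff)
      from barycentric_graph_bound[OF this[unfolded G_def]] show ?thesis
        by (simp add: dist_norm)
    qed
    moreover have "Cauchy s" using s(2) LIMSEQ_imp_Cauchy by blast
    ultimately have "Cauchy v" unfolding Cauchy_def by (meson le_less_trans)
    then obtain w where w: "v \<longlonglongrightarrow> w" unfolding Cauchy_convergent_iff convergent_def ..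
    have "(\<lambda>n. (s n, v n)) \<longlonglongrightarrow> (\<mu>, w)" by (intro tendsto_Pair s(2) w)
    with v show ?thesis unfolding closure_sequential
      by (intro exI[where x=w] exI[where x="\<lambda>n. (s n, v n)"]) auto
  qed
  then obtain b where b: "\<And>\<mu>. (\<mu>, b \<mu>) \<in> closure G" by metis
  have uniq: "v = b \<mu>" if "(\<mu>, v) \<in> closure G" for \<mu> v
  proof -
    have "(\<mu>, v) - (\<mu>, b \<mu>) \<in> closure G" using that b by (intro subspace_diff[OF sub])
    then show ?thesis using bd[of 0 "v - b \<mu>"] by simp
  qed
  have bl: "bounded_linear b"
  proof (rule bounded_linear_intro[where K=1])
    fix \<mu> \<nu> r
    show "b (\<mu> + \<nu>) = b \<mu> + b \<nu>"
      using subspace_add[OF sub b b, of \<mu> \<nu>] by (intro uniq[symmetric]) simp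
    show "b (r *\<^sub>R \<mu>) = r *\<^sub>R b \<mu>"
      using subspace_scale[OF sub b, of r \<mu>] by (intro uniq[symmetric]) simp
    show "norm (b \<mu>) \<le> norm \<mu> * 1" using bd[OF b] by simp
  qed
  have ap: "blinfun_apply (Blinfun b) = b" by (rule bounded_linear_Blinfun_apply[OF bl])
  have "norm (Blinfun b) \<le> 1"
    by (rule norm_blinfun_bound) (use bd[OF b] in \<open>auto simp: ap\<close>)
  moreover have "b (delta x) = x" for x
  proof -
    have "(delta x, x) \<in> closure G"
      unfolding G_def by (intro subsetD[OF closure_subset] span_base) auto
    then show ?thesis by (rule uniq[symmetric])
  qed
  ultimately show ?thesis using ap by (intro exI[where x="Blinfun b"]) auto
qed

lemma blinfun_eq_on_delta:
  fixes b c :: "'a::{metric_space, zero} free \<Rightarrow>\<^sub>L 'b::real_normed_vector"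
  assumes "\<And>x. blinfun_apply b (delta x) = blinfun_apply c (delta x)"
  shows "b = c"
proof (rule blinfun_eqI)
  fix \<mu> :: "'a free"
  obtain s where s: "\<And>n. s n \<in> span (range delta)" "s \<longlonglongrightarrow> \<mu>"
    using closure_span_delta[where 'a='a] by (metis UNIV_I closure_sequential)
  have "blinfun_apply b \<nu> = blinfun_apply c \<nu>" if "\<nu> \<in> span (range delta)" for \<nu>
    using that by (induction rule: span_induct_alt) (auto simp: blinfun.bilinear_simps assms)
  then have "(\<lambda>n. blinfun_apply b (s n)) = (\<lambda>n. blinfun_apply c (s n))" using s(1) by auto
  moreover have "(\<lambda>n. blinfun_apply b (s n)) \<longlonglongrightarrow> blinfun_apply b \<mu>"
    "(\<lambda>n. blinfun_apply c (s n)) \<longlonglongrightarrow> blinfun_apply c \<mu>"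
    by (intro blinfun.tendsto tendsto_const s(2))+
  ultimately show "blinfun_apply b \<mu> = blinfun_apply c \<mu>" using LIMSEQ_unique by metis
qed

lemma barycentric_ex1: "\<exists>!b :: 'a::banach free \<Rightarrow>\<^sub>L 'a. \<forall>x. blinfun_apply b (delta x) = x"
  using barycentric_exists by (metis blinfun_eq_on_delta)

lemma barycentric_delta: "blinfun_apply barycentric (delta x) = x"
  using theI'[OF barycentric_ex1] unfolding barycentric_def by blast

lemma norm_barycentric_le: "norm (barycentric :: 'a::banach free \<Rightarrow>\<^sub>L 'a) \<le> 1"
  using barycentric_exists[where 'a='a] barycentric_ex1 barycentric_delta by metis


section \<open>Properties of a pair (X, Y)\<close>

text \<open>X is the whole type; only the subset Y is an argument.\<close>

definition lifting_property :: "'a::banach set \<Rightarrow> bool"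
  where "lifting_property Y \<longleftrightarrow> (\<exists>T :: 'a \<Rightarrow>\<^sub>L 'a free.
    blinfun_apply T ` Y \<subseteq> free_sub Y \<and> blinfun_apply barycentric \<circ> blinfun_apply T = id)"

definition lambda_BAP :: "real \<Rightarrow> 'a::banach set \<Rightarrow> bool"
  where "lambda_BAP c Y \<longleftrightarrow> (\<forall>\<epsilon>>0. \<forall>K. compact K \<longrightarrow> (\<exists>S :: 'a \<Rightarrow>\<^sub>L 'a.
    (\<exists>B. finite B \<and> range (blinfun_apply S) \<subseteq> span B) \<and> norm S \<le> c \<and>
    (\<forall>x\<in>K. norm (blinfun_apply S x - x) \<le> \<epsilon>) \<and> blinfun_apply S ` Y \<subseteq> Y))"

definition lambda_Lipschitz_BAP :: "real \<Rightarrow> 'a::banach set \<Rightarrow> bool"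
  where "lambda_Lipschitz_BAP c Y \<longleftrightarrow> (\<forall>\<epsilon>>0. \<forall>K. compact K \<longrightarrow> (\<exists>S :: 'a \<Rightarrow> 'a.
    (\<exists>B. finite B \<and> range S \<subseteq> span B) \<and> c-lipschitz_on UNIV S \<and>
    (\<forall>x\<in>K. norm (S x - x) \<le> \<epsilon>) \<and> S ` Y \<subseteq> Y))"

definition BAP :: "'a::banach set \<Rightarrow> bool"
  where "BAP Y \<longleftrightarrow> (\<exists>c\<ge>1. lambda_BAP c Y)"

definition Lipschitz_BAP :: "'a::banach set \<Rightarrow> bool"
  where "Lipschitz_BAP Y \<longleftrightarrow> (\<exists>c\<ge>1. lambda_Lipschitz_BAP c Y)"

end

theory Submission
  imports Defs
begin

text \<open>
  Why the equivalence holds. A bounded linear map is Lipschitz with constant its norm, so the BAP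
  implies the Lipschitz BAP with the same constant. For the converse let \<open>T\<close> be a linear lifting,
  and let \<open>S\<close> be a \<open>c\<close>-Lipschitz map with finite-dimensional range that preserves \<open>Y\<close>. After
  subtracting the constant \<open>S 0\<close>, which lies in \<open>Y\<close>, the map \<open>S\<close> factors as \<open>L \<circ> delta\<close> for a linear
  map \<open>L\<close> from the free space to \<open>X\<close> with norm at most \<open>c\<close> (\<open>lipschitz_linearization\<close>). The linear map \<open>L \<circ> T\<close>
  is the required approximation of the identity.

  Its range lies in the span that contains the range of \<open>S\<close>, and it preserves \<open>Y\<close>, because a
  bounded linear map that sends \<open>delta ` N\<close> into a closed subspace sends the whole free space over
  \<open>N\<close> there (\<open>free_sub_image_subset\<close>); finite-dimensional subspaces are closed
  (\<open>closed_span_finite\<close>).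

  It is close to the identity on a compact set \<open>K\<close> because \<open>L (T x) - x\<close> is the value at \<open>T x\<close> of
  \<open>L - barycentric\<close>, a map of norm at most \<open>c + 1\<close>. On \<open>delta x\<close> this difference is
  \<open>S x - S 0 - x\<close>. The compact set \<open>T ` K\<close> is nearly covered by finitely many
  finite combinations of point evaluations, so it is enough that \<open>S\<close> be close to the identity at
  the finitely many points involved and at \<open>0\<close> (\<open>small_on_compact_free\<close>). The finite set and the
  tolerance depend only on \<open>c\<close>, \<open>T\<close>, \<open>K\<close> and the required precision, so they can be fixed
  before \<open>S\<close> is chosen.
\<close>

section \<open>Finite-dimensional subspaces are closed\<close>

text \<open>If \<open>a\<close> has distance \<open>d > 0\<close> from a closed subspace, the coefficient of \<open>a\<close> in a vector of the
  enlarged span is bounded by the norm divided by \<open>d\<close>. Hence the coefficients along a convergent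
  sequence are Cauchy, and completeness of the scalars suffices.\<close>

lemma closed_span_insert:
  fixes a :: "'a::real_normed_vector"
  assumes cl: "closed (span S)"
  shows "closed (span (insert a S))"
proof (cases "a \<in> span S")
  case True
  then show ?thesis using cl by (simp add: span_redundant)
next
  case False
  with cl obtain d where "d > 0" and ball: "ball a d \<subseteq> - span S"
    using openE[of "- span S" a] by (auto simp: open_Compl)
  then have d: "d > 0" "\<And>s. s \<in> span S \<Longrightarrow> d \<le> dist a s" by force+
  have coeff: "\<bar>k\<bar> * d \<le> norm v" if v: "v - k *\<^sub>R a \<in> span S" for v k
  proof (cases "k = 0")
    case nz: False
    have "- inverse k *\<^sub>R (v - k *\<^sub>R a) \<in> span S" by (rule span_scale[OF v])
    from d(2)[OF this] have "d \<le> norm (inverse k *\<^sub>R v)"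
      using nz by (simp add: dist_norm scaleR_diff_right)
    then show ?thesis using nz by (simp add: field_simps)
  qed simp
  show ?thesis
  proof (rule closed_sequential_limits[THEN iffD2], intro allI impI, elim conjE)
    fix x l assume x: "\<forall>n. x n \<in> span (insert a S)" and l: "x \<longlonglongrightarrow> l"
    then have "\<forall>n. \<exists>k. x n - k *\<^sub>R a \<in> span S" by (simp add: span_breakdown_eq)
    then obtain k where k: "\<And>n. x n - k n *\<^sub>R a \<in> span S" by metis
    have bound: "d * dist (k m) (k n) \<le> dist (x m) (x n)" for m n
    proof -
      have "(x m - x n) - (k m - k n) *\<^sub>R a \<in> span S"
        using span_diff[OF k[of m] k[of n]] by (simp add: algebra_simps)
      from coeff[OF this] show ?thesis by (simp add: dist_norm mult.commute)
    qed
    have "Cauchy k"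
    proof (rule metric_CauchyI)
      fix e :: real assume "e > 0"
      with d(1) have "d * e > 0" by simp
      then obtain N where N: "\<And>m n. m \<ge> N \<Longrightarrow> n \<ge> N \<Longrightarrow> dist (x m) (x n) < d * e"
        using metric_CauchyD[OF LIMSEQ_imp_Cauchy[OF l]] by blast
      have "dist (k m) (k n) < e" if "m \<ge> N" "n \<ge> N" for m n
        using le_less_trans[OF bound N[OF that]] d(1) by simp
      then show "\<exists>N. \<forall>m\<ge>N. \<forall>n\<ge>N. dist (k m) (k n) < e" by blast
    qed
    then obtain q where q: "k \<longlonglongrightarrow> q" unfolding Cauchy_convergent_iff convergent_def ..
    have "(\<lambda>n. x n - k n *\<^sub>R a) \<longlonglongrightarrow> l - q *\<^sub>R a"
      by (intro tendsto_diff tendsto_scaleR l q tendsto_const)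
    from closed_sequentially[OF cl k this] show "l \<in> span (insert a S)"
      by (auto simp: span_breakdown_eq)
  qed
qed

lemma closed_span_finite:
  fixes B :: "'a::real_normed_vector set"
  assumes "finite B"
  shows "closed (span B)"
  using assms by induction (simp_all add: closed_span_insert)


section \<open>Linearization of Lipschitz maps on the free space\<close>

text \<open>The free space over \<open>M\<close> sits in the dual of \<open>Lip\<^sub>0(M)\<close>, so the map induced by \<open>S\<close> is
  the adjoint of \<open>f \<mapsto> f \<circ> S\<close>. It sends evaluation at \<open>x\<close> to evaluation at \<open>S x\<close>, and
  therefore maps one closed span of evaluations into the other.\<close>

lemma free_map_exists:
  fixes S :: "'a::{metric_space, zero} \<Rightarrow> 'b::{metric_space, zero}"
  assumes lip: "c-lipschitz_on UNIV S" and S0: "S 0 = 0"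
  shows "\<exists>F :: 'a free \<Rightarrow>\<^sub>L 'b free. norm F \<le> c \<and> (\<forall>x. blinfun_apply F (delta x) = delta (S x))"
proof -
  have c0: "0 \<le> c" by (rule lipschitz_on_nonneg[OF lip])
  have comp: "(c * norm f)-lipschitz_on UNIV (\<lambda>x. lip0_apply f (S x))" for f :: "'b lip0"
    using lipschitz_on_compose2[OF lip lipschitz_on_subset[OF lip0_lipschitz[of f] subset_UNIV]]
    by (simp add: mult.commute)
  define P where "P = (\<lambda>f :: 'b lip0. Lip0 (\<lambda>x. lip0_apply f (S x)))"
  have P: "lip0_apply (P f) x = lip0_apply f (S x)" for f x
    unfolding P_def using comp[of f] by (subst Lip0_inverse) (auto simp: S0 lip0_zero)
  have P': "lip0_apply (P f) = (\<lambda>x. lip0_apply f (S x))" for f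
    by (rule ext) (rule P)
  have normP: "norm (P f) \<le> norm f * c" for f
    using Lip_const_le[OF comp[of f]] by (simp add: norm_lip0.rep_eq P' mult.commute)
  have blP: "bounded_linear P"
    by (rule bounded_linear_intro[where K=c])
      (auto intro!: lip0_eqI normP simp: P lip0_apply_simps)
  define C where "C = Blinfun P"
  have C: "blinfun_apply C = P" unfolding C_def by (rule bounded_linear_Blinfun_apply[OF blP])
  have normC: "norm C \<le> c"
    by (rule norm_blinfun_bound[OF c0]) (use normP in \<open>auto simp: C mult.commute\<close>)
  define A where "A = (\<lambda>m :: 'a lip0 \<Rightarrow>\<^sub>L real. m o\<^sub>L C)"
  have blA: "bounded_linear A" unfolding A_def
    by (rule bounded_bilinear.bounded_linear_left[OF bounded_bilinear_blinfun_compose])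
  have ev: "A (ev x) = ev (S x)" for x
    by (rule blinfun_eqI) (simp add: A_def C ev.rep_eq P)
  have im: "A ` closure (span (range ev)) \<subseteq> closure (span (range ev))"
  proof -
    have "A ` span (range ev) = span (A ` range ev)"
      by (simp add: linear_span_image[OF bounded_linear.linear[OF blA]])
    also have "\<dots> \<subseteq> span (range ev)" by (intro span_mono) (auto simp: ev)
    also have "\<dots> \<subseteq> closure (span (range ev))" by (rule closure_subset)
    finally show ?thesis
      by (intro image_closure_subset linear_continuous_on[OF blA] closed_closure)
  qed
  define F where "F = (\<lambda>\<mu> :: 'a free. Free (A (free_apply \<mu>)) :: 'b free)"
  have F: "free_apply (F \<mu>) = A (free_apply \<mu>)" for \<mu>
    unfolding F_def using im free_apply[of \<mu>] by (intro Free_inverse) blast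
  have normF: "norm (F \<mu>) \<le> norm \<mu> * c" for \<mu>
  proof -
    have "norm (F \<mu>) = norm (free_apply \<mu> o\<^sub>L C)"
      by (simp add: F A_def flip: free_apply_simps(6))
    also have "\<dots> \<le> norm (free_apply \<mu>) * norm C" by (rule norm_blinfun_compose)
    also have "\<dots> \<le> norm \<mu> * c" using normC by (simp add: free_apply_simps mult_left_mono)
    finally show ?thesis .
  qed
  have blF: "bounded_linear F"
  proof (rule bounded_linear_intro[where K=c])
    show "F (\<mu> + \<nu>) = F \<mu> + F \<nu>" for \<mu> \<nu>
      by (simp add: F free_apply_simps linear_add[OF bounded_linear.linear[OF blA]]
          flip: free_apply_inject)
    show "F (r *\<^sub>R \<mu>) = r *\<^sub>R F \<mu>" for r \<mu>
      by (simp add: F free_apply_simps linear_scale[OF bounded_linear.linear[OF blA]]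
          flip: free_apply_inject)
  qed (rule normF)
  have ap: "blinfun_apply (Blinfun F) = F" by (rule bounded_linear_Blinfun_apply[OF blF])
  have "norm (Blinfun F) \<le> c"
    by (rule norm_blinfun_bound[OF c0]) (use normF in \<open>auto simp: ap mult.commute\<close>)
  moreover have "F (delta x) = delta (S x)" for x
    by (simp add: F ev delta.rep_eq flip: free_apply_inject)
  ultimately show ?thesis using ap by (intro exI[where x="Blinfun F"]) auto
qed

lemma lipschitz_linearization:
  fixes S :: "'a::{metric_space, zero} \<Rightarrow> 'b::banach"
  assumes lip: "c-lipschitz_on UNIV S" and S0: "S 0 = 0"
  obtains L :: "'a free \<Rightarrow>\<^sub>L 'b"
  where "norm L \<le> c" and "\<And>x. blinfun_apply L (delta x) = S x"
proof -
  obtain F :: "'a free \<Rightarrow>\<^sub>L 'b free" where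
    F: "norm F \<le> c" "\<And>x. blinfun_apply F (delta x) = delta (S x)"
    using free_map_exists[OF lip S0] by blast
  have "norm (barycentric o\<^sub>L F) \<le> norm (barycentric :: 'b free \<Rightarrow>\<^sub>L 'b) * norm F"
    by (rule norm_blinfun_compose)
  also have "\<dots> \<le> 1 * c" by (intro mult_mono norm_barycentric_le F(1)) auto
  finally have "norm (barycentric o\<^sub>L F) \<le> c" by simp
  then show thesis by (rule that) (simp add: F(2) barycentric_delta)
qed


section \<open>Testing bounded maps on point evaluations\<close>

lemma free_sub_image_subset:
  fixes L :: "'a::{metric_space, zero} free \<Rightarrow>\<^sub>L 'b::real_normed_vector"
  assumes W: "subspace W" "closed W" and LN: "\<And>x. x \<in> N \<Longrightarrow> blinfun_apply L (delta x) \<in> W"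
  shows "blinfun_apply L ` free_sub N \<subseteq> W"
proof -
  have "blinfun_apply L ` span (delta ` N) = span (blinfun_apply L ` delta ` N)"
    by (simp add: linear_span_image[OF bounded_linear.linear[OF blinfun.bounded_linear_right]])
  also have "\<dots> \<subseteq> W" using LN by (intro span_minimal W(1)) auto
  finally show ?thesis unfolding free_sub_def
    by (intro image_closure_subset W(2) linear_continuous_on[OF blinfun.bounded_linear_right])
qed

lemma small_on_span_delta:
  fixes \<nu> :: "'a::{metric_space, zero} free"
  assumes "\<nu> \<in> span (range delta)" and "\<eta> > 0"
  shows "\<exists>A \<rho>. finite A \<and> \<rho> > 0 \<and> (\<forall>D :: 'a free \<Rightarrow>\<^sub>L 'b::real_normed_vector.
    (\<forall>x\<in>A. norm (blinfun_apply D (delta x)) \<le> \<rho>) \<longrightarrow> norm (blinfun_apply D \<nu>) \<le> \<eta>)"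
  using assms
proof (induction arbitrary: \<eta> rule: span_induct_alt)
  case base
  then show ?case by (intro exI[where x="{}"] exI[where x=1]) auto
next
  case (step r d \<mu>)
  then obtain x where x: "d = delta x" by blast
  from step.IH[of "\<eta> / 2"] step.prems obtain A \<rho> where A: "finite A" "\<rho> > 0"
    and D: "\<And>D :: 'a free \<Rightarrow>\<^sub>L 'b. \<forall>x\<in>A. norm (blinfun_apply D (delta x)) \<le> \<rho>
      \<Longrightarrow> norm (blinfun_apply D \<mu>) \<le> \<eta> / 2" by fastforce
  define \<sigma> where "\<sigma> = min \<rho> (\<eta> / 2 / (\<bar>r\<bar> + 1))"
  have "\<sigma> > 0" unfolding \<sigma>_def using A(2) step.prems by simp
  moreover have "norm (blinfun_apply D (r *\<^sub>R d + \<mu>)) \<le> \<eta>"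
    if h: "\<forall>y\<in>insert x A. norm (blinfun_apply D (delta y)) \<le> \<sigma>" for D :: "'a free \<Rightarrow>\<^sub>L 'b"
  proof -
    have "norm (blinfun_apply D \<mu>) \<le> \<eta> / 2" using h by (intro D) (auto simp: \<sigma>_def)
    moreover have "\<bar>r\<bar> * norm (blinfun_apply D d) \<le> \<eta> / 2"
    proof -
      have "\<bar>r\<bar> * norm (blinfun_apply D d) \<le> (\<bar>r\<bar> + 1) * (\<eta> / 2 / (\<bar>r\<bar> + 1))"
        using h by (intro mult_mono) (auto simp: \<sigma>_def x)
      also have "\<dots> = \<eta> / 2" by (simp add: field_simps)
      finally show ?thesis .
    qed
    moreover have "norm (blinfun_apply D (r *\<^sub>R d + \<mu>))
        \<le> \<bar>r\<bar> * norm (blinfun_apply D d) + norm (blinfun_apply D \<mu>)"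
      using norm_triangle_ineq[of "r *\<^sub>R blinfun_apply D d" "blinfun_apply D \<mu>"]
      by (simp add: blinfun.bilinear_simps)
    ultimately show ?thesis by linarith
  qed
  ultimately show ?case using A(1)
    by (intro exI[where x="insert x A"] exI[where x=\<sigma>]) blast
qed

text \<open>Maps of norm at most \<open>c\<close> are equicontinuous, so smallness at the finitely many centres of a
  fine cover of \<open>C\<close> spreads to \<open>C\<close>. Finite combinations of point evaluations are dense, so the
  centres can be taken among them, and each one depends on finitely many points.\<close>

lemma small_on_compact_free:
  fixes C :: "'a::{metric_space, zero} free set"
  assumes C: "compact C" and "\<eta> > 0" and "c \<ge> 0"
  obtains A \<rho> where "finite A" and "\<rho> > 0"
    and "\<And>(D :: 'a free \<Rightarrow>\<^sub>L 'b::real_normed_vector) \<mu>. norm D \<le> c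
      \<Longrightarrow> (\<And>x. x \<in> A \<Longrightarrow> norm (blinfun_apply D (delta x)) \<le> \<rho>)
      \<Longrightarrow> \<mu> \<in> C \<Longrightarrow> norm (blinfun_apply D \<mu>) \<le> \<eta>"
proof -
  define r where "r = \<eta> / 2 / (c + 1)"
  have r: "r > 0" using assms by (simp add: r_def)
  have cr: "c * r \<le> \<eta> / 2" using assms by (simp add: r_def field_simps)
  have "C \<subseteq> (\<Union>\<nu>\<in>span (range delta). ball \<nu> r)"
  proof
    fix \<mu> :: "'a free"
    have "\<mu> \<in> closure (span (range delta))" by (simp add: closure_span_delta)
    then show "\<mu> \<in> (\<Union>\<nu>\<in>span (range delta). ball \<nu> r)"
      using r by (auto simp: closure_approachable)
  qed
  then obtain Q where Q: "Q \<subseteq> span (range delta)" "finite Q" "C \<subseteq> (\<Union>\<nu>\<in>Q. ball \<nu> r)"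
    using compactE_image[OF C, of "span (range delta)" "\<lambda>\<nu>. ball \<nu> r"] by auto
  have "\<forall>\<nu>\<in>Q. \<exists>A \<rho>. finite A \<and> \<rho> > 0 \<and> (\<forall>D :: 'a free \<Rightarrow>\<^sub>L 'b.
    (\<forall>x\<in>A. norm (blinfun_apply D (delta x)) \<le> \<rho>) \<longrightarrow> norm (blinfun_apply D \<nu>) \<le> \<eta> / 2)"
    using Q(1) assms(2) by (intro ballI small_on_span_delta) auto
  then obtain A \<rho> where A: "\<And>\<nu>. \<nu> \<in> Q \<Longrightarrow> finite (A \<nu>)" "\<And>\<nu>. \<nu> \<in> Q \<Longrightarrow> \<rho> \<nu> > 0"
    and D: "\<And>\<nu> D :: 'a free \<Rightarrow>\<^sub>L 'b. \<nu> \<in> Q \<Longrightarrow> \<forall>x\<in>A \<nu>. norm (blinfun_apply D (delta x)) \<le> \<rho> \<nu>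
      \<Longrightarrow> norm (blinfun_apply D \<nu>) \<le> \<eta> / 2" by metis
  \<comment> \<open>The extra element 1 keeps the minimum meaningful when \<open>C\<close>, and with it \<open>Q\<close>, is empty.\<close>
  define \<sigma> where "\<sigma> = Min (insert 1 (\<rho> ` Q))"
  have \<sigma>: "\<sigma> > 0" "\<And>\<nu>. \<nu> \<in> Q \<Longrightarrow> \<sigma> \<le> \<rho> \<nu>" using A(2) Q(2) by (auto simp: \<sigma>_def)
  show thesis
  proof (rule that)
    show "finite (\<Union>\<nu>\<in>Q. A \<nu>)" using A(1) Q(2) by blast
    show "\<sigma> > 0" by (rule \<sigma>(1))
    fix D :: "'a free \<Rightarrow>\<^sub>L 'b" and \<mu>
    assume nD: "norm D \<le> c" and small: "\<And>x. x \<in> (\<Union>\<nu>\<in>Q. A \<nu>) \<Longrightarrow> norm (blinfun_apply D (delta x)) \<le> \<sigma>"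
      and "\<mu> \<in> C"
    then obtain \<nu> where \<nu>: "\<nu> \<in> Q" "norm (\<mu> - \<nu>) < r"
      using Q(3) by (auto simp: dist_norm norm_minus_commute)
    have "norm (blinfun_apply D \<nu>) \<le> \<eta> / 2"
      using \<nu>(1) small \<sigma>(2)[OF \<nu>(1)] by (intro D) (auto intro: order_trans)
    moreover have "norm (blinfun_apply D (\<mu> - \<nu>)) \<le> \<eta> / 2"
    proof -
      have "norm (blinfun_apply D (\<mu> - \<nu>)) \<le> norm D * norm (\<mu> - \<nu>)" by (rule norm_blinfun)
      also have "\<dots> \<le> c * r" using nD \<nu>(2) assms(3) by (intro mult_mono) auto
      finally show ?thesis using cr by linarith
    qed
    moreover have "norm (blinfun_apply D \<mu>)
        \<le> norm (blinfun_apply D (\<mu> - \<nu>)) + norm (blinfun_apply D \<nu>)"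
      using norm_triangle_ineq[of "blinfun_apply D (\<mu> - \<nu>)" "blinfun_apply D \<nu>"]
      by (simp add: blinfun.bilinear_simps)
    ultimately show "norm (blinfun_apply D \<mu>) \<le> \<eta>" by linarith
  qed
qed


section \<open>The two approximation properties\<close>

lemma lambda_BAP_imp_lambda_Lipschitz_BAP:
  assumes "lambda_BAP c Y"
  shows "lambda_Lipschitz_BAP c Y"
  unfolding lambda_Lipschitz_BAP_def
proof (intro allI impI)
  fix \<epsilon> :: real and K :: "'a set"
  assume \<epsilon>: "\<epsilon> > 0" and K: "compact K"
  obtain S :: "'a \<Rightarrow>\<^sub>L 'a" and B where
    S: "finite B" "range (blinfun_apply S) \<subseteq> span B" and S': "norm S \<le> c"
       "\<forall>x\<in>K. norm (blinfun_apply S x - x) \<le> \<epsilon>" "blinfun_apply S ` Y \<subseteq> Y"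
    using assms[unfolded lambda_BAP_def, rule_format, OF \<epsilon> K] by (elim exE conjE) (rule that)
  have "c-lipschitz_on UNIV (blinfun_apply S)"
  proof (rule lipschitz_onI)
    show "0 \<le> c" using S'(1) norm_ge_zero[of S] by linarith
    fix x y
    have "dist (blinfun_apply S x) (blinfun_apply S y) \<le> norm S * dist x y"
      using norm_blinfun[of S "x - y"] by (simp add: dist_norm blinfun.bilinear_simps)
    also have "\<dots> \<le> c * dist x y" using S'(1) by (intro mult_right_mono) auto
    finally show "dist (blinfun_apply S x) (blinfun_apply S y) \<le> c * dist x y" .
  qed
  with S S' show "\<exists>S. (\<exists>B. finite B \<and> range S \<subseteq> span B) \<and> c-lipschitz_on UNIV S \<and>
      (\<forall>x\<in>K. norm (S x - x) \<le> \<epsilon>) \<and> S ` Y \<subseteq> Y"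
    by (intro exI[where x="blinfun_apply S"] conjI exI[where x=B])
qed

text \<open>The constant of the linear approximations is that of the Lipschitz ones multiplied by the
  norm of the lifting, since they are obtained by composing linearizations with it.\<close>

lemma lambda_Lipschitz_BAP_imp_lambda_BAP:
  fixes Y :: "'a::banach set" and T :: "'a \<Rightarrow>\<^sub>L 'a free"
  assumes Y: "subspace Y" "closed Y"
    and TY: "blinfun_apply T ` Y \<subseteq> free_sub Y"
    and \<beta>T: "\<And>x. blinfun_apply barycentric (blinfun_apply T x) = x"
    and c: "0 \<le> c" and lip: "lambda_Lipschitz_BAP c Y"
  shows "lambda_BAP (c * norm T) Y"
  unfolding lambda_BAP_def
proof (intro allI impI)
  fix \<epsilon> :: real and K :: "'a set"
  assume \<epsilon>: "\<epsilon> > 0" and K: "compact K"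
  have TK: "compact (blinfun_apply T ` K)"
    by (intro compact_continuous_image K linear_continuous_on[OF blinfun.bounded_linear_right])
  have c1: "0 \<le> c + 1" using c by simp
  obtain A \<rho> where A: "finite A" "\<rho> > 0"
    and small: "\<And>(D :: 'a free \<Rightarrow>\<^sub>L 'a) \<mu>. norm D \<le> c + 1
      \<Longrightarrow> (\<And>x. x \<in> A \<Longrightarrow> norm (blinfun_apply D (delta x)) \<le> \<rho>)
      \<Longrightarrow> \<mu> \<in> blinfun_apply T ` K \<Longrightarrow> norm (blinfun_apply D \<mu>) \<le> \<epsilon>"
    using small_on_compact_free[OF TK \<epsilon> c1, where 'b='a] by metis
  \<comment> \<open>Half of the tolerance goes to the error of \<open>S\<close> at a point of \<open>A\<close>, half to that at \<open>0\<close>.\<close>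
  have "compact (insert 0 A)" "\<rho> / 2 > 0" using A by (auto intro: finite_imp_compact)
  with lip obtain S B where S: "finite B" "range S \<subseteq> span B" "c-lipschitz_on UNIV S"
    "\<And>x. x \<in> insert 0 A \<Longrightarrow> norm (S x - x) \<le> \<rho> / 2" "S ` Y \<subseteq> Y"
    unfolding lambda_Lipschitz_BAP_def by metis
  have "c-lipschitz_on UNIV (\<lambda>x. S x - S 0)"
    using S(3) by (simp add: lipschitz_on_def dist_norm)
  then obtain L :: "'a free \<Rightarrow>\<^sub>L 'a" where
    L: "norm L \<le> c" "\<And>x. blinfun_apply L (delta x) = S x - S 0"
    by (rule lipschitz_linearization) auto
  let ?R = "L o\<^sub>L T"
  have "range (blinfun_apply ?R) \<subseteq> span B"
  proof -
    have "blinfun_apply L ` free_sub UNIV \<subseteq> span B"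
      using S(2) by (intro free_sub_image_subset subspace_span closed_span_finite S(1))
        (auto simp: L(2) intro: span_diff)
    then show ?thesis by (auto simp: free_sub_def closure_span_delta)
  qed
  moreover have "norm ?R \<le> c * norm T"
    using norm_blinfun_compose[of L T] mult_right_mono[OF L(1) norm_ge_zero[of T]] by linarith
  moreover have "norm (blinfun_apply ?R x - x) \<le> \<epsilon>" if "x \<in> K" for x
  proof -
    have "norm (blinfun_apply (L - barycentric) (blinfun_apply T x)) \<le> \<epsilon>"
    proof (rule small)
      show "norm (L - barycentric) \<le> c + 1"
        using norm_triangle_ineq4[of L barycentric] L(1) norm_barycentric_le[where 'a='a]
        by linarith
      show "norm (blinfun_apply (L - barycentric) (delta a)) \<le> \<rho>" if "a \<in> A" for a
      proof -
        have "blinfun_apply (L - barycentric) (delta a) = (S a - a) - (S 0 - 0)"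
          by (simp add: blinfun.bilinear_simps L(2) barycentric_delta)
        then show ?thesis
          using norm_triangle_ineq4[of "S a - a" "S 0 - 0"] S(4)[of a] S(4)[of 0] that by simp
      qed
    qed (use that in blast)
    then show ?thesis by (simp add: blinfun.bilinear_simps \<beta>T)
  qed
  moreover have "blinfun_apply ?R ` Y \<subseteq> Y"
  proof -
    have "blinfun_apply L ` free_sub Y \<subseteq> Y"
      using S(5) subspace_0[OF Y(1)]
      by (intro free_sub_image_subset Y) (auto simp: L(2) intro!: subspace_diff[OF Y(1)])
    then show ?thesis using TY by auto
  qed
  ultimately show "\<exists>R :: 'a \<Rightarrow>\<^sub>L 'a. (\<exists>B. finite B \<and> range (blinfun_apply R) \<subseteq> span B) \<and>
      norm R \<le> c * norm T \<and> (\<forall>x\<in>K. norm (blinfun_apply R x - x) \<le> \<epsilon>) \<and> blinfun_apply R ` Y \<subseteq> Y"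
    using S(1) by blast
qed

lemma lambda_BAP_mono: "lambda_BAP c Y \<Longrightarrow> c \<le> d \<Longrightarrow> lambda_BAP d Y"
  unfolding lambda_BAP_def by (meson order_trans)

theorem theorem6p9:
  fixes Y :: "'a::banach set"
  assumes "separable_space (euclidean :: 'a topology)"
    and "subspace Y" and "closed Y"
    and "lifting_property Y"
  shows "BAP Y \<longleftrightarrow> Lipschitz_BAP Y"
proof
  assume "BAP Y"
  then show "Lipschitz_BAP Y"
    unfolding BAP_def Lipschitz_BAP_def using lambda_BAP_imp_lambda_Lipschitz_BAP by blast
next
  assume "Lipschitz_BAP Y"
  then obtain c where c: "c \<ge> 1" "lambda_Lipschitz_BAP c Y" unfolding Lipschitz_BAP_def by blast
  obtain T :: "'a \<Rightarrow>\<^sub>L 'a free" where T: "blinfun_apply T ` Y \<subseteq> free_sub Y"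
    and \<beta>T: "blinfun_apply barycentric \<circ> blinfun_apply T = id"
    using assms(4) unfolding lifting_property_def by blast
  have "lambda_BAP (c * norm T) Y"
    using assms(2,3) T fun_cong[OF \<beta>T] c by (intro lambda_Lipschitz_BAP_imp_lambda_BAP) auto
  \<comment> \<open>On the zero space \<open>T\<close> has norm 0, hence the maximum with 1.\<close>
  then have "lambda_BAP (max 1 (c * norm T)) Y" by (rule lambda_BAP_mono) simp
  then show "BAP Y" unfolding BAP_def by (meson max.cobounded1)
qed

end
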